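(* Let $\Bbbk$ be a field of characteristic zero, $H=\Bbbk[\partial]$, $\alpha\in\Bbbk$, and let $V=\mathcal V_\alpha=Hv$ be the Novikov conformal algebra which is a free $H$-module of rank one with $v\circ_{(\lambda)}v=(\partial+\lambda+\alpha)v$. Then $H^2(V,V)=\Bbbk\,\bar\varepsilon$, where $\varepsilon\in Z^2(V,V)$ is determined by $\varepsilon_\lambda(v,v)=v$ and $\bar\varepsilon=\varepsilon+B^2(V,V)$.
   Context: A conformal algebra is an $H$-module $V$ with a $\Bbbk$-bilinear operation $V\times V\to V[\lambda]$, $(a,b)\mapsto a\circ_{(\lambda)}b$, which is sesqui-linear: $(\partial a)\circ_{(\lambda)}b=-\lambda(a\circ_{(\lambda)}b)$, $a\circ_{(\lambda)}(\partial b)=(\partial+\lambda)(a\circ_{(\lambda)}b)$. If $a\circ_{(\lambda)}b=\sum_n\lambda^n c_n$, put $\{a\circ_{(\lambda)}b\}=a\circ_{(-\partial-\lambda)}b:=\sum_n(-\partial-\lambda)^nc_n$. It is a Novikov conformal algebra if for all $a,b,c\in V$ (products extended coefficientwise) $$(a\circ_{(\lambda)}b)\circ_{(\lambda+\mu)}c-a\circ_{(\lambda)}(b\circ_{(\mu)}c)=(b\circ_{(\mu)}a)\circ_{(\lambda+\mu)}c-b\circ_{(\mu)}(a\circ_{(\lambda)}c),$$ $$(a\circ_{(\lambda)}b)\circ_{(\mu)}c=\{(a\circ_{(\lambda)}c)\circ_{(\mu-\lambda)}b\}.$$ For a Novikov conformal algebra $V$, $Z^2(V,V)$ is the space of all $\Bbbk$-linear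 maps $f_\lambda:V\otimes V\to V[\lambda]$ such that for all $u,v,w\in V$ $$f_\lambda(\partial u,v)=-\lambda f_\lambda(u,v),\qquad f_\lambda(u,\partial v)=(\lambda+\partial)f_\lambda(u,v);$$ $$u\circ_{(\lambda)}f_\mu(v,w)-f_{\lambda+\mu}(u\circ_{(\lambda)}v,w)+f_\lambda(u,v\circ_{(\mu)}w)-f_\lambda(u,v)\circ_{(\lambda+\mu)}w$$ $$=v\circ_{(\mu)}f_\lambda(u,w)-f_{\lambda+\mu}(v\circ_{(\mu)}u,w)+f_\mu(v,u\circ_{(\lambda)}w)-f_\mu(v,u)\circ_{(\lambda+\mu)}w;$$ $$f_{\lambda+\mu}(u\circ_{(\lambda)}v,w)+f_\lambda(u,v)\circ_{(\lambda+\mu)}w=\{f_\lambda(u,w)\circ_{(\mu)}v\}+f_{-\partial-\mu}(u\circ_{(\lambda)}w,v).$$ All maps are extended coefficientwise to polynomials, and $f_{-\partial-\mu}(x,y):=\sum_n(-\partial-\mu)^nc_n$ if $f_\lambda(x,y)=\sum_n\lambda^nc_n$. $B^2(V,V)\subseteq Z^2(V,V)$ is the subspace of all $d^1\tau$, where $\tau:V\to V$ is $H$-linear and $(d^1\tau)_\lambda(u,v)=u\circ_{(\lambda)}\tau(v)-\tau(u\circ_{(\lambda)}v)+\tau(u)\circ_{(\lambda)}v$. Finally $H^2(V,V)=Z^2(V,V)/B^2(V,V)$ (this space describes infinitesimal conformal deformations of $V$ up to equivalence). A map satisfying the first pair of relations on $V=Hv$ is completely determined by its value at $(v,v)$. 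*)

theory Defs
  imports "HOL-Computational_Algebra.Polynomial" "HOL-Library.Set_Algebras"
    "HOL-Library.Function_Algebras"
begin

text \<open>
  The ring \<open>H = \<Bbbk>[\<partial>]\<close> is the type \<open>'k poly\<close>, and an \<open>H\<close>-module is a type \<open>'v\<close> with an action
  \<open>scale\<close> such that \<open>module scale\<close>. The groups \<open>V[\<lambda>]\<close> and \<open>V[\<lambda>,\<mu>]\<close> are \<open>'v poly\<close> and
  \<open>'v poly poly\<close>, where \<open>\<lambda>\<close> is the inner and \<open>\<mu>\<close> the outer variable; they are modules over
  \<open>H[\<lambda>]\<close> and \<open>H[\<lambda>,\<mu>]\<close>, that is, over \<open>'k poly poly\<close> and \<open>'k poly poly poly\<close>.
\<close>

text \<open>The action of \<open>R[x]\<close> on \<open>M[x]\<close> induced by an action of \<open>R\<close> on \<open>M\<close>.\<close>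

definition poly_scale ::
  "('r::zero \<Rightarrow> 'm::comm_monoid_add \<Rightarrow> 'm) \<Rightarrow> 'r poly \<Rightarrow> 'm poly \<Rightarrow> 'm poly" where
  "poly_scale s p q =
     (\<Sum>i\<le>degree p. \<Sum>j\<le>degree q. monom (s (coeff p i) (coeff q j)) (i + j))"

text \<open>The variables \<open>\<partial>\<close> and \<open>\<lambda>\<close> as elements of \<open>H[\<lambda>]\<close>.\<close>

abbreviation del1 :: "'k::comm_ring_1 poly poly" where "del1 \<equiv> [:[:0, 1:]:]"
abbreviation lam1 :: "'k::comm_ring_1 poly poly" where "lam1 \<equiv> [:0, 1:]"

text \<open>The variables \<open>\<partial>\<close>, \<open>\<lambda>\<close> and \<open>\<mu>\<close> as elements of \<open>H[\<lambda>,\<mu>]\<close>.\<close>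

abbreviation del2 :: "'k::comm_ring_1 poly poly poly" where "del2 \<equiv> [:[:[:0, 1:]:]:]"
abbreviation lam2 :: "'k::comm_ring_1 poly poly poly" where "lam2 \<equiv> [:[:0, 1:]:]"
abbreviation mu2 :: "'k::comm_ring_1 poly poly poly" where "mu2 \<equiv> [:0, 1:]"

text \<open>
  For an additive map \<open>\<phi> : V \<rightarrow> V[\<lambda>,\<mu>]\<close>, an element \<open>s\<close> of \<open>H[\<lambda>,\<mu>]\<close> and \<open>P = \<Sum>n. x\<^sup>n c\<^sub>n\<close>
  with \<open>c\<^sub>n \<in> V\<close>, this is \<open>\<Sum>n. s\<^sup>n \<phi>(c\<^sub>n)\<close>.
\<close>

definition extend ::
  "('k::comm_ring_1 poly \<Rightarrow> 'v::comm_monoid_add \<Rightarrow> 'v) \<Rightarrow> 'k poly poly poly \<Rightarrow>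
     ('v \<Rightarrow> 'v poly poly) \<Rightarrow> 'v poly \<Rightarrow> 'v poly poly" where
  "extend scale s \<phi> P =
     (\<Sum>n\<le>degree P. poly_scale (poly_scale scale) (s ^ n) (\<phi> (coeff P n)))"

text \<open>\<open>subst_var scale t P\<close> is \<open>P\<close> with its variable replaced by \<open>t \<in> H[\<lambda>,\<mu>]\<close>.\<close>

definition subst_var ::
  "('k::comm_ring_1 poly \<Rightarrow> 'v::comm_monoid_add \<Rightarrow> 'v) \<Rightarrow> 'k poly poly poly \<Rightarrow>
     'v poly \<Rightarrow> 'v poly poly" where
  "subst_var scale t = extend scale t (\<lambda>x. [:[:x:]:])"

text \<open>
  For \<open>g\<^sub>\<lambda> : V \<times> V \<rightarrow> V[\<lambda>]\<close>, these are \<open>g\<^sub>t(P(s), w)\<close> and \<open>g\<^sub>t(u, P(s))\<close>, where \<open>g\<^sub>t\<close> is extended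
  coefficientwise to polynomials. The choice \<open>t = -\<partial>-\<mu>\<close> yields \<open>{P(s) \<circ>\<^sub>(\<^sub>\<mu>\<^sub>) w}\<close> for \<open>g = \<circ>\<close>.
\<close>

definition ext_left ::
  "('k::comm_ring_1 poly \<Rightarrow> 'v::comm_monoid_add \<Rightarrow> 'v) \<Rightarrow> ('v \<Rightarrow> 'v \<Rightarrow> 'v poly) \<Rightarrow>
     'k poly poly poly \<Rightarrow> 'k poly poly poly \<Rightarrow> 'v poly \<Rightarrow> 'v \<Rightarrow> 'v poly poly" where
  "ext_left scale g t s P w = extend scale s (\<lambda>x. subst_var scale t (g x w)) P"

definition ext_right ::
  "('k::comm_ring_1 poly \<Rightarrow> 'v::comm_monoid_add \<Rightarrow> 'v) \<Rightarrow> ('v \<Rightarrow> 'v \<Rightarrow> 'v poly) \<Rightarrow>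
     'k poly poly poly \<Rightarrow> 'k poly poly poly \<Rightarrow> 'v \<Rightarrow> 'v poly \<Rightarrow> 'v poly poly" where
  "ext_right scale g t s u P = extend scale s (\<lambda>x. subst_var scale t (g u x)) P"

text \<open>\<open>\<Bbbk>\<close>-bilinear maps \<open>V \<times> V \<rightarrow> V[\<lambda>]\<close> (equivalently, \<open>\<Bbbk>\<close>-linear maps \<open>V \<otimes> V \<rightarrow> V[\<lambda>]\<close>) that
  are sesqui-linear.\<close>

definition k_bilinear ::
  "('k::field poly \<Rightarrow> 'v::ab_group_add \<Rightarrow> 'v) \<Rightarrow> ('v \<Rightarrow> 'v \<Rightarrow> 'v poly) \<Rightarrow> bool" where
  "k_bilinear scale f \<longleftrightarrow>
     (\<forall>u. Vector_Spaces.linear (\<lambda>c. scale [:c:]) (\<lambda>c. poly_scale scale [:[:c:]:]) (\<lambda>w. f u w)) \<and>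
     (\<forall>w. Vector_Spaces.linear (\<lambda>c. scale [:c:]) (\<lambda>c. poly_scale scale [:[:c:]:]) (\<lambda>u. f u w))"

definition sesquilinear ::
  "('k::field poly \<Rightarrow> 'v::ab_group_add \<Rightarrow> 'v) \<Rightarrow> ('v \<Rightarrow> 'v \<Rightarrow> 'v poly) \<Rightarrow> bool" where
  "sesquilinear scale f \<longleftrightarrow>
     (\<forall>u w. f (scale [:0, 1:] u) w = poly_scale scale (- lam1) (f u w)) \<and>
     (\<forall>u w. f u (scale [:0, 1:] w) = poly_scale scale (del1 + lam1) (f u w))"

locale conformal_algebra = module scale
  for scale :: "'k::field poly \<Rightarrow> 'v::ab_group_add \<Rightarrow> 'v" +
  fixes circ :: "'v \<Rightarrow> 'v \<Rightarrow> 'v poly"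
  assumes circ_bilinear: "k_bilinear scale circ"
    and circ_sesquilinear: "sesquilinear scale circ"

locale novikov_conformal_algebra = conformal_algebra scale circ
  for scale :: "'k::field poly \<Rightarrow> 'v::ab_group_add \<Rightarrow> 'v" and circ +
  assumes left_symmetric:
    "ext_left scale circ (lam2 + mu2) lam2 (circ a b) c
       - ext_right scale circ lam2 mu2 a (circ b c)
     = ext_left scale circ (lam2 + mu2) mu2 (circ b a) c
       - ext_right scale circ mu2 lam2 b (circ a c)"
    and right_commutative:
    "ext_left scale circ mu2 lam2 (circ a b) c
     = ext_left scale circ (- del2 - (mu2 - lam2)) lam2 (circ a c) b"

definition Z2 ::
  "('k::field poly \<Rightarrow> 'v::ab_group_add \<Rightarrow> 'v) \<Rightarrow> ('v \<Rightarrow> 'v \<Rightarrow> 'v poly) \<Rightarrow>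
     ('v \<Rightarrow> 'v \<Rightarrow> 'v poly) set" where
  "Z2 scale circ = {f. k_bilinear scale f \<and> sesquilinear scale f \<and>
     (\<forall>u v w.
        ext_right scale circ lam2 mu2 u (f v w)
        - ext_left scale f (lam2 + mu2) lam2 (circ u v) w
        + ext_right scale f lam2 mu2 u (circ v w)
        - ext_left scale circ (lam2 + mu2) lam2 (f u v) w
      = ext_right scale circ mu2 lam2 v (f u w)
        - ext_left scale f (lam2 + mu2) mu2 (circ v u) w
        + ext_right scale f mu2 lam2 v (circ u w)
        - ext_left scale circ (lam2 + mu2) mu2 (f v u) w) \<and>
     (\<forall>u v w.
        ext_left scale f (lam2 + mu2) lam2 (circ u v) w
        + ext_left scale circ (lam2 + mu2) lam2 (f u v) w
      = ext_left scale circ (- del2 - mu2) lam2 (f u w) v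
        + ext_left scale f (- del2 - mu2) lam2 (circ u w) v)}"

definition d1 ::
  "('v::ab_group_add \<Rightarrow> 'v \<Rightarrow> 'v poly) \<Rightarrow> ('v \<Rightarrow> 'v) \<Rightarrow> 'v \<Rightarrow> 'v \<Rightarrow> 'v poly" where
  "d1 circ \<tau> u w = circ u (\<tau> w) - map_poly \<tau> (circ u w) + circ (\<tau> u) w"

definition B2 ::
  "('k::field poly \<Rightarrow> 'v::ab_group_add \<Rightarrow> 'v) \<Rightarrow> ('v \<Rightarrow> 'v \<Rightarrow> 'v poly) \<Rightarrow>
     ('v \<Rightarrow> 'v \<Rightarrow> 'v poly) set" where
  "B2 scale circ = {d1 circ \<tau> | \<tau>. module_hom scale scale \<tau>}"

text \<open>The quotient \<open>Z\<^sup>2/B\<^sup>2\<close> as the set of cosets \<open>f + B\<^sup>2\<close> (with pointwise addition of maps),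
  and multiplication of a coset by a scalar.\<close>

definition H2 ::
  "('k::field poly \<Rightarrow> 'v::ab_group_add \<Rightarrow> 'v) \<Rightarrow> ('v \<Rightarrow> 'v \<Rightarrow> 'v poly) \<Rightarrow>
     ('v \<Rightarrow> 'v \<Rightarrow> 'v poly) set set" where
  "H2 scale circ = (\<lambda>f. f +o B2 scale circ) ` Z2 scale circ"

definition H2_scale ::
  "('k::field poly \<Rightarrow> 'v::ab_group_add \<Rightarrow> 'v) \<Rightarrow> ('v \<Rightarrow> 'v \<Rightarrow> 'v poly) \<Rightarrow> 'k \<Rightarrow>
     ('v \<Rightarrow> 'v \<Rightarrow> 'v poly) set \<Rightarrow> ('v \<Rightarrow> 'v \<Rightarrow> 'v poly) set" where
  "H2_scale scale circ c X =
     (\<Union>f\<in>X. (\<lambda>u w. poly_scale scale [:[:c:]:] (f u w)) +o B2 scale circ)"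

end

theory Submission
  imports Defs
begin

text \<open>
  Identify \<open>V = Hv\<close> with \<open>\<Bbbk>[\<partial>]\<close>. A sesqui-linear map \<open>f\<close> is determined by its symbol
  \<open>F(\<partial>,\<lambda>)\<close>, where \<open>f\<^sub>\<lambda>(v,v) = F(\<partial>,\<lambda>)v\<close>, since
  \<open>f\<^sub>\<lambda>(p(\<partial>)v, q(\<partial>)v) = p(-\<lambda>) q(\<partial>+\<lambda>) F(\<partial>,\<lambda>) v\<close>. As \<open>\<Bbbk>\<close> is infinite, an identity in \<open>V[\<lambda>,\<mu>]\<close>
  may be tested by giving \<open>\<partial>\<close>, \<open>\<lambda>\<close>, \<open>\<mu>\<close> arbitrary values \<open>x\<close>, \<open>l\<close>, \<open>m\<close> in \<open>\<Bbbk>\<close>. In this way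
  the two cocycle identities become two functional equations for \<open>F\<close> (\<open>Z2_iff\<close>), and \<open>f\<close> is
  a coboundary iff \<open>F(x,l) = (x+l+\<alpha>) (h(x+l) - h(x) + h(-l))\<close> for some polynomial \<open>h\<close>, the
  coordinate of \<open>\<tau>(v)\<close> (\<open>B2_iff\<close>).

  The heart of the proof is that every solution \<open>F\<close> is a constant \<open>c\<close> plus the symbol of a
  coboundary (\<open>cocycle_functional_equations\<close>). On the line \<open>x+l+\<alpha> = 0\<close> the second equation
  forces \<open>F\<close> to be a constant \<open>c\<close>, so \<open>F(x,l) = c + (x+l+\<alpha>) G(x,l)\<close>. For the functions
  \<open>J\<^sub>w(x) = G(x,-w-x)\<close> the second equation then reads \<open>\<Delta>\<^sub>s J\<^sub>w = \<Delta>\<^sub>w J\<^sub>s\<close>, with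
  \<open>\<Delta>\<^sub>s f(x) = f(x+s) - f(x)\<close>. In characteristic zero the operator \<open>\<Delta>\<^sub>1\<close> is surjective on polynomials
  and its kernel consists of the constants; choosing \<open>p\<close> with \<open>\<Delta>\<^sub>1 p = J\<^sub>1\<close> therefore gives
  \<open>J\<^sub>w = \<Delta>\<^sub>w p + const(w)\<close>. This determines \<open>G\<close> up to the one-variable function
  \<open>g(x) = G(x,0)\<close>, and the first equation says that \<open>(x+\<alpha>) g(x)\<close> is additive up to a constant.
  Additive polynomials are linear, so \<open>g\<close> is constant, and \<open>h\<close> is \<open>p\<close> plus a constant.

  Conversely, constants solve both equations, so they are the symbols of the multiples of
  \<open>\<epsilon>\<close>. Finally \<open>\<epsilon>\<close> is no coboundary because its symbol 1 does not vanish where \<open>x+l+\<alpha> = 0\<close>.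
\<close>

section \<open>Polynomial functions of one variable\<close>

definition polyfun :: "('k::comm_ring_1 \<Rightarrow> 'k) \<Rightarrow> bool" where
  "polyfun f \<longleftrightarrow> (\<exists>p. \<forall>x. f x = poly p x)"

lemma polyfun_poly: "polyfun f \<Longrightarrow> polyfun (\<lambda>x. poly p (f x))"
  unfolding polyfun_def by (metis poly_pcompose)

lemma polyfun_const: "polyfun (\<lambda>x. c)"
  unfolding polyfun_def by (rule exI[of _ "[:c:]"]) auto

lemma polyfun_id: "polyfun (\<lambda>x. x)"
  unfolding polyfun_def by (rule exI[of _ "[:0, 1:]"]) auto

lemma polyfun_add: "polyfun f \<Longrightarrow> polyfun g \<Longrightarrow> polyfun (\<lambda>x. f x + g x)"
  unfolding polyfun_def by (metis poly_add)

lemma polyfun_minus: "polyfun f \<Longrightarrow> polyfun (\<lambda>x. - f x)"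
  unfolding polyfun_def by (metis poly_minus)

lemma polyfun_diff: "polyfun f \<Longrightarrow> polyfun g \<Longrightarrow> polyfun (\<lambda>x. f x - g x)"
  unfolding polyfun_def by (metis poly_diff)

lemma polyfun_mult: "polyfun f \<Longrightarrow> polyfun g \<Longrightarrow> polyfun (\<lambda>x. f x * g x)"
  unfolding polyfun_def by (metis poly_mult)

lemmas polyfun_intros =
  polyfun_const polyfun_id polyfun_add polyfun_minus polyfun_diff polyfun_mult polyfun_poly

lemma polyfun_eq_zero_if_infinitely_many_roots:
  fixes f :: "'k::field_char_0 \<Rightarrow> 'k"
  assumes "polyfun f" and "infinite {x. f x = 0}"
  shows "f x = 0"
proof -
  obtain p where p: "\<And>x. f x = poly p x"
    using assms(1) unfolding polyfun_def by blast
  then have "p = 0"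
    using assms(2) poly_roots_finite[of p] by auto
  with p show ?thesis
    by simp
qed

lemma polyfun_eq_zero_if_cofinite_roots:
  fixes f :: "'k::field_char_0 \<Rightarrow> 'k"
  assumes "polyfun f" and "finite S" and "\<And>y. y \<notin> S \<Longrightarrow> f y = 0"
  shows "f x = 0"
proof (rule polyfun_eq_zero_if_infinitely_many_roots[OF assms(1)])
  have "infinite (- S)"
    using assms(2) infinite_UNIV_char_0 by (metis finite_compl)
  moreover have "- S \<subseteq> {y. f y = 0}"
    using assms(3) by blast
  ultimately show "infinite {y. f y = 0}"
    using infinite_super by blast
qed

text \<open>A period 1 makes the value at 0 be taken at every natural number.\<close>

lemma periodic_polyfun_constant:
  fixes f :: "'k::field_char_0 \<Rightarrow> 'k"
  assumes "polyfun f" and "\<And>x. f (x + 1) = f x"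
  shows "f x = f 0"
proof -
  have "f (of_nat n) = f 0" for n
    by (induction n) (simp_all add: assms(2) add.commute[of 1])
  then have "range of_nat \<subseteq> {x. f x - f 0 = 0}"
    by auto
  then have "infinite {x. f x - f 0 = 0}"
    using infinite_super range_inj_infinite inj_of_nat by blast
  then have "f x - f 0 = 0"
    by (rule polyfun_eq_zero_if_infinitely_many_roots[rotated])
       (intro polyfun_intros assms(1))
  then show ?thesis
    by simp
qed

lemma additive_polyfun_linear:
  fixes f :: "'k::field_char_0 \<Rightarrow> 'k"
  assumes "polyfun f" and add: "\<And>x y. f (x + y) = f x + f y"
  shows "f x = f 1 * x"
proof -
  have "f x - f 1 * x = f 0 - f 1 * 0"
    by (rule periodic_polyfun_constant[where f = "\<lambda>x. f x - f 1 * x"])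
       (auto intro!: polyfun_intros assms(1) simp: add algebra_simps)
  moreover have "f 0 = 0"
    using add[of 0 0] by simp
  ultimately show ?thesis
    by simp
qed

text \<open>
  The image of the difference operator is a subspace, and \<open>(x+1)\<^sup>n\<^sup>+\<^sup>1 - x\<^sup>n\<^sup>+\<^sup>1\<close> has leading term
  \<open>(n+1) x\<^sup>n\<close>, where \<open>n+1\<close> is invertible. So all powers of \<open>x\<close> lie in the image by strong
  induction.
\<close>

lemma forward_difference_surjective:
  fixes q :: "'k::field_char_0 poly"
  shows "\<exists>p. \<forall>x. poly p (x + 1) - poly p x = poly q x"
proof -
  define D where "D = {q :: 'k poly. \<exists>p. \<forall>x. poly p (x + 1) - poly p x = poly q x}"
  have add: "q + r \<in> D" if "q \<in> D" "r \<in> D" for q r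
  proof -
    obtain p p' where "\<forall>x. poly p (x + 1) - poly p x = poly q x"
      "\<forall>x. poly p' (x + 1) - poly p' x = poly r x"
      using \<open>q \<in> D\<close> \<open>r \<in> D\<close> unfolding D_def by blast
    then have "\<forall>x. poly (p + p') (x + 1) - poly (p + p') x = poly (q + r) x"
      by (simp add: algebra_simps)
    then show ?thesis
      unfolding D_def by blast
  qed
  have smult: "smult c q \<in> D" if "q \<in> D" for c q
  proof -
    obtain p where "\<forall>x. poly p (x + 1) - poly p x = poly q x"
      using \<open>q \<in> D\<close> unfolding D_def by blast
    then have "\<forall>x. poly (smult c p) (x + 1) - poly (smult c p) x = poly (smult c q) x"
      by (simp flip: right_diff_distrib)
    then show ?thesis
      unfolding D_def by blast
  qed
  have zero: "0 \<in> D"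
    unfolding D_def by (auto intro: exI[of _ 0])
  have sum: "(\<Sum>i\<in>I. t i) \<in> D" if "finite I" "\<And>i. i \<in> I \<Longrightarrow> t i \<in> D" for I :: "nat set" and t
    using that by (induction I rule: finite_induct) (auto intro: zero add)
  have monom: "monom 1 n \<in> D" for n
  proof (induction n rule: less_induct)
    case (less n)
    define r where "r = (\<Sum>k<n. smult (of_nat (Suc n choose k)) (monom 1 k :: 'k poly))"
    have r: "r \<in> D"
      unfolding r_def by (intro sum smult less) auto
    have "poly (monom 1 (Suc n)) (x + 1) - poly (monom 1 (Suc n)) x
        = poly (r + smult (of_nat (Suc n)) (monom 1 n)) x" for x :: 'k
    proof -
      have "(x + 1) ^ Suc n = (\<Sum>k\<le>Suc n. of_nat (Suc n choose k) * x ^ k)"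
        by (subst binomial_ring) simp
      also have "\<dots> = (\<Sum>k<n. of_nat (Suc n choose k) * x ^ k)
          + of_nat (Suc n) * x ^ n + x ^ Suc n"
        by (simp add: lessThan_Suc_atMost[symmetric] del: binomial_Suc_Suc)
      finally show ?thesis
        by (simp add: r_def poly_monom poly_sum del: binomial_Suc_Suc of_nat_Suc power_Suc)
    qed
    then have "r + smult (of_nat (Suc n)) (monom 1 n) \<in> D"
      unfolding D_def by blast
    from add[OF this smult[OF r, of "-1"]] have "smult (of_nat (Suc n)) (monom 1 n) \<in> D"
      by simp
    from smult[OF this, of "inverse (of_nat (Suc n))"] show ?case
      by (simp del: of_nat_Suc)
  qed
  have "q = (\<Sum>i\<le>degree q. smult (coeff q i) (monom 1 i))"
    by (simp add: smult_monom poly_as_sum_of_monoms)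
  then have "q \<in> D"
    using sum[of "{..degree q}" "\<lambda>i. smult (coeff q i) (monom 1 i)"] smult monom by simp
  then show ?thesis
    unfolding D_def by blast
qed

section \<open>Evaluation of polynomials\<close>

text \<open>
  Coefficients are first sent to the field by \<open>e\<close>. Iterating this gives evaluation at a point of
  elements of \<open>H[\<lambda>]\<close> and \<open>H[\<lambda>,\<mu>]\<close> as well as of \<open>V[\<lambda>]\<close> and \<open>V[\<lambda>,\<mu>]\<close>, in each case from the
  evaluation one level below.
\<close>

definition eval_with :: "('a::zero \<Rightarrow> 'k::comm_ring_1) \<Rightarrow> 'k \<Rightarrow> 'a poly \<Rightarrow> 'k" where
  "eval_with e t P = poly (map_poly e P) t"

lemma eval_with_0 [simp]: "eval_with e t 0 = 0"
  by (simp add: eval_with_def)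

lemma eval_with_pCons:
  assumes "e 0 = 0"
  shows "eval_with e t (pCons a P) = e a + t * eval_with e t P"
  by (simp add: eval_with_def map_poly_pCons assms)

lemma eval_with_add:
  fixes e :: "'a::comm_monoid_add \<Rightarrow> 'k::comm_ring_1"
  assumes "e 0 = 0" and "\<And>a b. e (a + b) = e a + e b"
  shows "eval_with e t (P + Q) = eval_with e t P + eval_with e t Q"
proof -
  have "map_poly e (P + Q) = map_poly e P + map_poly e Q"
    by (rule poly_eqI) (simp add: coeff_map_poly assms)
  then show ?thesis
    by (simp add: eval_with_def)
qed

lemma eval_with_sum:
  fixes e :: "'a::comm_monoid_add \<Rightarrow> 'k::comm_ring_1"
  assumes "e 0 = 0" and "\<And>a b. e (a + b) = e a + e b"
  shows "eval_with e t (\<Sum>i\<in>I. P i) = (\<Sum>i\<in>I. eval_with e t (P i))"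
  by (induction I rule: infinite_finite_induct) (simp_all add: eval_with_add assms)

lemma eval_with_monom:
  assumes "e 0 = 0"
  shows "eval_with e t (monom a n) = e a * t ^ n"
  by (simp add: eval_with_def map_poly_monom assms poly_monom)

lemma eval_with_altdef:
  fixes e :: "'a::comm_monoid_add \<Rightarrow> 'k::comm_ring_1"
  assumes "e 0 = 0" and "\<And>a b. e (a + b) = e a + e b"
  shows "eval_with e t P = (\<Sum>i\<le>degree P. e (coeff P i) * t ^ i)"
proof -
  have "eval_with e t (\<Sum>i\<le>degree P. monom (coeff P i) i) = (\<Sum>i\<le>degree P. e (coeff P i) * t ^ i)"
    by (simp add: eval_with_sum eval_with_monom assms)
  then show ?thesis
    by (simp add: poly_as_sum_of_monoms)
qed

text \<open>
  Compatibility of evaluation with a module action passes from coefficients to polynomials; this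
  is what turns \<^const>\<open>poly_scale\<close> into multiplication in the field.
\<close>

lemma eval_with_poly_scale:
  fixes e :: "'m::comm_monoid_add \<Rightarrow> 'k::comm_ring_1" and \<rho> :: "'r::comm_monoid_add \<Rightarrow> 'k"
  assumes e: "e 0 = 0" "\<And>a b. e (a + b) = e a + e b"
    and \<rho>: "\<rho> 0 = 0" "\<And>a b. \<rho> (a + b) = \<rho> a + \<rho> b"
    and s: "\<And>a b. e (s a b) = \<rho> a * e b"
  shows "eval_with e t (poly_scale s p q) = eval_with \<rho> t p * eval_with e t q"
proof -
  have "eval_with e t (poly_scale s p q)
      = (\<Sum>i\<le>degree p. \<Sum>j\<le>degree q. \<rho> (coeff p i) * e (coeff q j) * t ^ (i + j))"
    by (simp add: poly_scale_def eval_with_sum eval_with_monom e s)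
  also have "\<dots> = eval_with \<rho> t p * eval_with e t q"
    by (simp add: eval_with_altdef[of e] eval_with_altdef[of \<rho>] e \<rho>
        sum_product power_add mult_ac)
  finally show ?thesis .
qed

lemma eval_with_mult:
  fixes \<rho> :: "'a::comm_ring_1 \<Rightarrow> 'k::comm_ring_1"
  assumes "\<rho> 0 = 0" and "\<And>a b. \<rho> (a + b) = \<rho> a + \<rho> b" and "\<And>a b. \<rho> (a * b) = \<rho> a * \<rho> b"
  shows "eval_with \<rho> t (p * q) = eval_with \<rho> t p * eval_with \<rho> t q"
proof -
  have "eval_with \<rho> t (smult a q) = \<rho> a * eval_with \<rho> t q" for a q
    by (induction q) (simp_all add: eval_with_pCons assms algebra_simps)
  then show ?thesis
    by (induction p) (simp_all add: eval_with_pCons eval_with_add assms algebra_simps)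
qed

lemma eval_with_eqD:
  fixes P Q :: "'a::zero poly" and e :: "'a \<Rightarrow> 'k::field_char_0"
  assumes "e 0 = 0" and "\<And>t. eval_with e t P = eval_with e t Q"
  shows "e (coeff P n) = e (coeff Q n)"
proof -
  have "map_poly e P = map_poly e Q"
    using assms(2) unfolding eval_with_def by (simp add: poly_eq_poly_eq_iff[symmetric] fun_eq_iff)
  then show ?thesis
    by (metis coeff_map_poly assms(1))
qed

text \<open>
  Evaluation of elements of \<open>H[\<lambda>]\<close> at \<open>\<partial> = x\<close>, \<open>\<lambda> = l\<close>, and below of elements of
  \<open>H[\<lambda>,\<mu>]\<close> at \<open>\<partial> = x\<close>, \<open>\<lambda> = l\<close>, \<open>\<mu> = m\<close>.
\<close>

definition poly2 :: "'k::comm_ring_1 \<Rightarrow> 'k \<Rightarrow> 'k poly poly \<Rightarrow> 'k" where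
  "poly2 x l = eval_with (\<lambda>p. poly p x) l"

definition poly3 :: "'k::comm_ring_1 \<Rightarrow> 'k \<Rightarrow> 'k \<Rightarrow> 'k poly poly poly \<Rightarrow> 'k" where
  "poly3 x l m = eval_with (poly2 x l) m"

lemma poly2_simps [simp]:
  "poly2 x l 0 = 0"
  "poly2 x l (pCons p B) = poly p x + l * poly2 x l B"
  "poly2 x l 1 = 1"
  "poly2 x l (A + B) = poly2 x l A + poly2 x l B"
  "poly2 x l (A * B) = poly2 x l A * poly2 x l B"
  by (simp_all add: poly2_def eval_with_pCons eval_with_add eval_with_mult one_pCons)

lemma poly2_minus [simp]: "poly2 x l (- A) = - poly2 x l A"
  using poly2_simps(4)[of x l A "- A"] by (simp add: eq_neg_iff_add_eq_0 add.commute)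

lemma poly2_diff [simp]: "poly2 x l (A - B) = poly2 x l A - poly2 x l B"
  using poly2_simps(4)[of x l A "- B"] by simp

lemma poly2_smult [simp]: "poly2 x l (smult p A) = poly p x * poly2 x l A"
  using poly2_simps(5)[of x l "[:p:]" A] by (simp del: poly2_simps(5))

lemma poly3_simps [simp]:
  "poly3 x l m 0 = 0"
  "poly3 x l m (pCons p B) = poly2 x l p + m * poly3 x l m B"
  "poly3 x l m 1 = 1"
  "poly3 x l m (A + B) = poly3 x l m A + poly3 x l m B"
  "poly3 x l m (A * B) = poly3 x l m A * poly3 x l m B"
  by (simp_all add: poly3_def eval_with_pCons eval_with_add eval_with_mult one_pCons)

lemma poly3_minus [simp]: "poly3 x l m (- A) = - poly3 x l m A"
  using poly3_simps(4)[of x l m A "- A"] by (simp add: eq_neg_iff_add_eq_0 add.commute)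

lemma poly3_diff [simp]: "poly3 x l m (A - B) = poly3 x l m A - poly3 x l m B"
  using poly3_simps(4)[of x l m A "- B"] by simp

lemma poly3_power [simp]: "poly3 x l m (A ^ n) = poly3 x l m A ^ n"
  by (induction n) simp_all

lemma poly_poly_eq_poly2: "poly (poly B q) x = poly2 x (poly q x) B"
  by (induction B) simp_all

lemma polyfun_poly2:
  assumes "polyfun f" and "polyfun g"
  shows "polyfun (\<lambda>t. poly2 (f t) (g t) B)"
  by (induction B) (auto intro!: polyfun_intros assms)

section \<open>Functional equations for symbols of cocycles\<close>

text \<open>
  The solutions of the cocycle equations for a symbol \<open>F\<close>: a constant plus the symbol of a
  coboundary. Wherever a linear factor has to be cancelled, both sides are polynomial functions
  of \<open>m\<close>, so it suffices to compare them off the zeros of that factor.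
\<close>

lemma cocycle_functional_equations:
  fixes F :: "'k::field_char_0 poly poly" and \<alpha> :: 'k
  assumes left_sym: "\<And>x l m.
      poly2 (x + l) m F * (x + l + \<alpha>) - (\<alpha> - m) * poly2 x (l + m) F
        + (x + l + m + \<alpha>) * poly2 x l F - poly2 (- l - m) l F * (x + l + m + \<alpha>)
      = poly2 (x + m) l F * (x + m + \<alpha>) - (\<alpha> - l) * poly2 x (l + m) F
        + (x + l + m + \<alpha>) * poly2 x m F - poly2 (- l - m) m F * (x + l + m + \<alpha>)"
    and right_comm: "\<And>x l m.
      (\<alpha> - m) * poly2 x (l + m) F + poly2 (- l - m) l F * (x + l + m + \<alpha>)
      = poly2 (x + m) l F * (\<alpha> - m) + (x + l + m + \<alpha>) * poly2 x (- x - m) F"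
  shows "\<exists>c h. \<forall>x l. poly2 x l F = c + (x + l + \<alpha>) * (poly h (x + l) - poly h x + poly h (- l))"
proof -
  \<comment> \<open>\<open>\<phi>\<close> is \<open>F\<close> on the line \<open>x + l + \<alpha> = 0\<close>. For \<open>x + l + m + \<alpha> = 0\<close> two terms of the second equation
    vanish, and the other two are values of \<open>\<phi>\<close> times \<open>\<alpha> - m\<close>.\<close>
  define \<phi> where "\<phi> s = poly2 (- s - \<alpha>) s F" for s
  have step: "\<phi> (s + t) = \<phi> s" if "t \<noteq> \<alpha>" for s t
  proof -
    have "- (s + t) - \<alpha> + t = - s - \<alpha>" "- (s + t) - \<alpha> + s + t + \<alpha> = 0"
      by simp_all
    with right_comm[where x = "- (s + t) - \<alpha>" and l = s and m = t]
    have "(\<alpha> - t) * (\<phi> (s + t) - \<phi> s) = 0"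
      by (simp add: \<phi>_def right_diff_distrib mult.commute)
    with that show ?thesis
      by simp
  qed
  have \<phi>_const: "\<phi> s = \<phi> 0" for s
  proof (cases "s = \<alpha> \<and> s \<noteq> 0")
    case True
    \<comment> \<open>The step of length \<open>\<alpha>\<close> is excluded, but two steps of half that length are not.\<close>
    then have "\<alpha> / 2 \<noteq> \<alpha>"
      by (auto simp: field_simps)
    then show ?thesis
      using step[of "\<alpha> / 2" "\<alpha> / 2"] step[of "\<alpha> / 2" 0] True by simp
  next
    case False
    then show ?thesis
      using step[of s 0] by auto
  qed
  define c where "c = \<phi> 0"
  have "poly (poly F [:- \<alpha>, - 1:]) = poly [:c:]"
  proof
    fix x
    have "- (- \<alpha> - x) - \<alpha> = x"
      by simp
    then show "poly (poly F [:- \<alpha>, - 1:]) x = poly [:c:] x"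
      using \<phi>_const[of "- \<alpha> - x"] by (simp add: poly_poly_eq_poly2 c_def \<phi>_def)
  qed
  then have "poly (F - [:[:c:]:]) [:- \<alpha>, - 1:] = 0"
    by (simp add: poly_eq_poly_eq_iff)
  then obtain G where "F - [:[:c:]:] = [:- [:- \<alpha>, - 1:], 1:] * G"
    unfolding poly_eq_0_iff_dvd by (auto elim: dvdE)
  then have "F = [:[:c:]:] + [:[:\<alpha>, 1:], 1:] * G"
    by (simp add: algebra_simps)
  then have F: "poly2 x l F = c + (x + l + \<alpha>) * poly2 x l G" for x l
    by (simp add: algebra_simps)
  have G_right_comm: "poly2 x (l + m) G - poly2 (x + m) l G
      - (poly2 x (- x - m) G - poly2 (- l - m) l G) = 0" for x l m
  proof (rule polyfun_eq_zero_if_cofinite_roots[where x = m and S = "{\<alpha>, - x - l - \<alpha>}"])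
    fix m assume "m \<notin> {\<alpha>, - x - l - \<alpha>}"
    then have nz: "\<alpha> - m \<noteq> 0" "x + l + m + \<alpha> \<noteq> 0"
      by (auto simp: algebra_simps eq_neg_iff_add_eq_0)
    have "(\<alpha> - m) * (x + l + m + \<alpha>) * (poly2 x (l + m) G - poly2 (x + m) l G
      - (poly2 x (- x - m) G - poly2 (- l - m) l G)) = 0"
      using right_comm[of m x l] unfolding F by algebra
    with nz show "poly2 x (l + m) G - poly2 (x + m) l G
      - (poly2 x (- x - m) G - poly2 (- l - m) l G) = 0"
      by simp
  qed (auto intro!: polyfun_intros polyfun_poly2)
  have G_left_sym: "(x + l + \<alpha>) * (poly2 (x + l) m G + poly2 x l G)
        - (\<alpha> - m) * (poly2 x (l + m) G + poly2 (- l - m) l G)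
      - ((x + m + \<alpha>) * (poly2 (x + m) l G + poly2 x m G)
        - (\<alpha> - l) * (poly2 x (l + m) G + poly2 (- l - m) m G)) = 0" for x l m
  proof (rule polyfun_eq_zero_if_cofinite_roots[where x = m and S = "{- x - l - \<alpha>}"])
    fix m assume "m \<notin> {- x - l - \<alpha>}"
    then have nz: "x + l + m + \<alpha> \<noteq> 0"
      by (auto simp: algebra_simps eq_neg_iff_add_eq_0)
    have "(x + l + m + \<alpha>) * ((x + l + \<alpha>) * (poly2 (x + l) m G + poly2 x l G)
        - (\<alpha> - m) * (poly2 x (l + m) G + poly2 (- l - m) l G)
      - ((x + m + \<alpha>) * (poly2 (x + m) l G + poly2 x m G)
        - (\<alpha> - l) * (poly2 x (l + m) G + poly2 (- l - m) m G))) = 0"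
      using left_sym[of x l m] unfolding F by algebra
    with nz show "(x + l + \<alpha>) * (poly2 (x + l) m G + poly2 x l G)
        - (\<alpha> - m) * (poly2 x (l + m) G + poly2 (- l - m) l G)
      - ((x + m + \<alpha>) * (poly2 (x + m) l G + poly2 x m G)
        - (\<alpha> - l) * (poly2 x (l + m) G + poly2 (- l - m) m G)) = 0"
      by simp
  qed (auto intro!: polyfun_intros polyfun_poly2)
  \<comment> \<open>Restricting \<open>G\<close> to the lines \<open>x + y = - w\<close> makes its equation a symmetry of mixed differences.\<close>
  define J where "J w x = poly2 x (- w - x) G" for w x
  have J_poly: "polyfun (J w)" for w
    unfolding J_def by (intro polyfun_intros polyfun_poly2)
  have J_comm: "J w (x + s) - J w x = J s (x + w) - J s x" for w s x
  proof -
    have args: "- s - (x + w) + s = - w - x" "- (- s - (x + w)) - s = x + w"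
      "- w - (x + s) = - s - (x + w)" "- x - s = - s - x"
      by simp_all
    show ?thesis
      using G_right_comm[of x "- w - (x + s)" s] unfolding J_def args by algebra
  qed
  obtain q where q: "\<And>x. J 1 x = poly q x"
    using J_poly[of 1] unfolding polyfun_def by blast
  obtain p where p: "\<And>x. poly p (x + 1) - poly p x = J 1 x"
    using forward_difference_surjective[of q] unfolding q by blast
  \<comment> \<open>\<open>J w\<close> and the \<open>w\<close>-difference of \<open>p\<close> have the same 1-difference, hence differ by a constant.\<close>
  have J: "J w x = poly p (x + w) - poly p x + (J w 0 - poly p w + poly p 0)" for w x
  proof -
    define f where "f x = J w x - (poly p (x + w) - poly p x)" for x
    have "f (x + 1) = f x" for x
      using J_comm[of w x 1] p[of x] p[of "x + w"] unfolding f_def by (simp add: algebra_simps)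
    moreover have "polyfun f"
      unfolding f_def by (intro polyfun_intros J_poly)
    ultimately have "f x = f 0"
      by (rule periodic_polyfun_constant[rotated])
    then show ?thesis
      by (simp add: f_def algebra_simps)
  qed
  define g where "g x = poly2 x 0 G" for x
  have G: "poly2 x y G = poly p (- y) - poly p x + poly p (x + y) + g (x + y) - poly p 0" for x y
  proof -
    have args: "- (- x - y) - x = y" "- (- x - y) - (x + y) = 0" "x + (- x - y) = - y"
      "x + y + (- x - y) = 0"
      by simp_all
    show ?thesis
      using J[of "- x - y" x] J[of "- x - y" "x + y"] unfolding J_def g_def args by algebra
  qed
  \<comment> \<open>In terms of \<open>p\<close> and \<open>g\<close>, all occurrences of \<open>p\<close> cancel in the first equation.\<close>
  define k where "k x = (x + \<alpha>) * g x" for x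
  have k: "k (x + l) + k (- l) = k (x + m) + k (- m)" for x l m
    using G_left_sym[of x l m] unfolding G k_def
    by (simp add: algebra_simps)
  have k_add: "k (x + y) - k 0 = (k x - k 0) + (k y - k 0)" for x y
  proof -
    have "k (x + y) + k (- y) = k x + k 0" "k y + k (- y) = k 0 + k 0"
      using k[of x y 0] k[of 0 y 0] by simp_all
    then show ?thesis
      by algebra
  qed
  have k_poly: "polyfun (\<lambda>x. k x - k 0)"
    unfolding k_def g_def by (intro polyfun_intros polyfun_poly2)
  define b where "b = k 1 - k 0"
  have k_lin: "k x - k 0 = b * x" for x
    unfolding b_def by (rule additive_polyfun_linear[OF k_poly]) (rule k_add)
  have g: "g x - b = 0" for x
  proof (rule polyfun_eq_zero_if_cofinite_roots[where S = "{- \<alpha>}" and x = x])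
    fix x assume "x \<notin> {- \<alpha>}"
    then have "x + \<alpha> \<noteq> 0"
      by (auto simp: eq_neg_iff_add_eq_0)
    moreover have "(x + \<alpha>) * (g x - b) = 0"
      using k_lin[of x] k_lin[of "- \<alpha>"] unfolding k_def by algebra
    ultimately show "g x - b = 0"
      by simp
  qed (auto simp: g_def intro!: polyfun_intros polyfun_poly2)
  \<comment> \<open>A constant \<open>h\<close> contributes itself, so the constant values of \<open>g\<close> and \<open>- p 0\<close> go into \<open>h\<close>.\<close>
  define h where "h = p + [:b - poly p 0:]"
  have "poly2 x l G = poly h (x + l) - poly h x + poly h (- l)" for x l
    using g[of "x + l"] unfolding G h_def by (simp add: algebra_simps)
  then have "poly2 x l F = c + (x + l + \<alpha>) * (poly h (x + l) - poly h x + poly h (- l))" for x l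
    by (simp only: F)
  then show ?thesis
    by blast
qed

section \<open>Evaluation on a free module of rank one\<close>

locale free_rank_one = module scale
  for scale :: "'k::field_char_0 poly \<Rightarrow> 'v::ab_group_add \<Rightarrow> 'v" +
  fixes v :: 'v
  assumes independent: "\<not> dependent {v}" and spanning: "span {v} = UNIV"
begin

lemma scale_v_eq_iff: "scale p v = scale q v \<longleftrightarrow> p = q"
proof
  assume "scale p v = scale q v"
  then have "scale (p - q) v = 0"
    by (simp add: scale_left_diff_distrib)
  then have "p - q = 0"
    using independent dependent_finite[of "{v}"] by (auto dest: spec[of _ "\<lambda>_. p - q"])
  then show "p = q"
    by simp
qed simp

lemma generated_by_v: "\<exists>p. u = scale p v"
  using spanning unfolding span_singleton by blast

text \<open>
  The identification of \<open>V = Hv\<close> with \<open>H\<close>. Composed with \<open>\<partial> \<mapsto> x\<close> it gives an evaluation \<open>V \<rightarrow> \<Bbbk>\<close>,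
  from which the evaluations of \<open>V[\<lambda>]\<close> and \<open>V[\<lambda>,\<mu>]\<close> are built.
\<close>

definition coord :: "'v \<Rightarrow> 'k poly" where
  "coord u = (THE p. u = scale p v)"

lemma coord_scale_v [simp]: "coord (scale p v) = p"
  unfolding coord_def by (simp add: scale_v_eq_iff)

lemma scale_coord [simp]: "scale (coord u) v = u"
  by (metis generated_by_v coord_scale_v)

lemma coord_eq_iff: "coord u = coord w \<longleftrightarrow> u = w"
  by (metis scale_coord)

lemma coord_add [simp]: "coord (u + w) = coord u + coord w"
  by (metis scale_coord scale_left_distrib coord_scale_v)

lemma coord_scale [simp]: "coord (scale p u) = p * coord u"
  by (metis scale_coord scale_scale coord_scale_v)

lemma coord_0 [simp]: "coord 0 = 0"
  using coord_scale_v[of 0] by simp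

lemma coord_v [simp]: "coord v = 1"
  using coord_scale_v[of 1] by simp

definition val1 :: "'k \<Rightarrow> 'v \<Rightarrow> 'k" where
  "val1 x u = poly (coord u) x"

definition val2 :: "'k \<Rightarrow> 'k \<Rightarrow> 'v poly \<Rightarrow> 'k" where
  "val2 x l = eval_with (val1 x) l"

definition val3 :: "'k \<Rightarrow> 'k \<Rightarrow> 'k \<Rightarrow> 'v poly poly \<Rightarrow> 'k" where
  "val3 x l m = eval_with (val2 x l) m"

lemma val1_simps [simp]:
  "val1 x 0 = 0"
  "val1 x (u + w) = val1 x u + val1 x w"
  "val1 x (scale p u) = poly p x * val1 x u"
  "val1 x v = 1"
  by (simp_all add: val1_def)

lemma val2_simps [simp]:
  "val2 x l 0 = 0"
  "val2 x l (pCons u P) = val1 x u + l * val2 x l P"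
  "val2 x l (P + Q) = val2 x l P + val2 x l Q"
  "val2 x l (poly_scale scale A P) = poly2 x l A * val2 x l P"
  by (simp_all add: val2_def poly2_def eval_with_pCons eval_with_add eval_with_poly_scale)

lemma val2_diff [simp]: "val2 x l (P - Q) = val2 x l P - val2 x l Q"
  using val2_simps(3)[of x l "P - Q" Q] by simp

lemma val3_simps [simp]:
  "val3 x l m 0 = 0"
  "val3 x l m (pCons P R) = val2 x l P + m * val3 x l m R"
  "val3 x l m (R + S) = val3 x l m R + val3 x l m S"
  "val3 x l m (poly_scale (poly_scale scale) A R) = poly3 x l m A * val3 x l m R"
  by (simp_all add: val3_def poly3_def eval_with_pCons eval_with_add eval_with_poly_scale)

lemma val3_diff [simp]: "val3 x l m (R - S) = val3 x l m R - val3 x l m S"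
  using val3_simps(3)[of x l m "R - S" S] by simp

lemma val3_sum [simp]: "val3 x l m (\<Sum>i\<in>I. R i) = (\<Sum>i\<in>I. val3 x l m (R i))"
  by (simp add: val3_def eval_with_sum)

text \<open>A polynomial over an infinite field is determined by its values, one variable at a time.\<close>

lemma val2_eqI:
  assumes "\<And>x l. val2 x l P = val2 x l Q"
  shows "P = Q"
proof (rule poly_eqI)
  fix n
  have "poly (coord (coeff P n)) = poly (coord (coeff Q n))"
    using eval_with_eqD[of "val1 _" P Q n] assms
    by (auto simp: val2_def val1_def fun_eq_iff)
  then show "coeff P n = coeff Q n"
    by (simp add: poly_eq_poly_eq_iff coord_eq_iff)
qed

lemma val3_eqI:
  assumes "\<And>x l m. val3 x l m R = val3 x l m S"
  shows "R = S"
proof (rule poly_eqI)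
  fix n
  show "coeff R n = coeff S n"
    using eval_with_eqD[of "val2 _ _" R S n] assms
    by (intro val2_eqI) (auto simp: val3_def)
qed

lemma val2_altdef: "val2 x l P = (\<Sum>n\<le>degree P. l ^ n * val1 x (coeff P n))"
  by (simp add: val2_def eval_with_altdef mult.commute)

lemma val3_extend:
  "val3 x l m (extend scale s \<phi> P)
     = (\<Sum>n\<le>degree P. poly3 x l m s ^ n * val3 x l m (\<phi> (coeff P n)))"
  by (simp add: extend_def)

lemma val3_subst_var: "val3 x l m (subst_var scale t P) = val2 x (poly3 x l m t) P"
  by (simp add: subst_var_def val3_extend val2_altdef)

section \<open>Symbols of sesqui-linear maps\<close>

definition symbol :: "('v \<Rightarrow> 'v \<Rightarrow> 'v poly) \<Rightarrow> 'k \<Rightarrow> 'k \<Rightarrow> 'k" where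
  "symbol f x l = val2 x l (f v v)"

lemma vector_space_V: "vector_space (\<lambda>c. scale [:c:])"
proof
  show "scale [:a + b:] u = scale [:a:] u + scale [:b:] u" for a b u
    using scale_left_distrib[of "[:a:]" "[:b:]" u] by simp
  show "scale [:1:] u = u" for u
    using scale_one[of u] by (simp add: one_pCons)
qed (simp_all add: scale_right_distrib mult.commute)

lemma vector_space_V_poly: "vector_space (\<lambda>c. poly_scale scale [:[:c:]:])"
  by standard (auto intro!: val2_eqI simp: algebra_simps)

lemma k_bilinear_iff:
  "k_bilinear scale f \<longleftrightarrow>
     (\<forall>u w w'. f u (w + w') = f u w + f u w') \<and>
     (\<forall>c u w. f u (scale [:c:] w) = poly_scale scale [:[:c:]:] (f u w)) \<and>
     (\<forall>u u' w. f (u + u') w = f u w + f u' w) \<and>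
     (\<forall>c u w. f (scale [:c:] u) w = poly_scale scale [:[:c:]:] (f u w))"
  unfolding k_bilinear_def Vector_Spaces.linear_iff
  using vector_space_V vector_space_V_poly by blast

text \<open>
  Sesqui-linearity moves \<open>\<partial>\<close> out of the first argument as \<open>-\<lambda>\<close> and out of the second as \<open>\<partial>+\<lambda>\<close>.
\<close>

lemma val2_sesquilinear:
  assumes "k_bilinear scale f" and "sesquilinear scale f"
  shows "val2 x l (f u w) = val1 (- l) u * val1 (x + l) w * symbol f x l"
proof -
  have scale_pCons: "scale (pCons a p) y = scale [:a:] y + scale [:0, 1:] (scale p y)" for a p y
    using scale_left_distrib[of "[:a:]" "[:0, 1:] * p" y] by simp
  have left: "val2 x l (f (scale p v) y) = poly p (- l) * val2 x l (f v y)" for p y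
  proof (induction p)
    case 0
    show ?case
      using assms(1) unfolding k_bilinear_iff
      by (metis (no_types, lifting) add_cancel_right_right mult_zero_left poly_0 scale_zero_left
          val2_simps(1))
  next
    case (pCons a p)
    then show ?case
      using assms unfolding scale_pCons[of a p] k_bilinear_iff sesquilinear_def
      by (simp add: algebra_simps del: scale_scale)
  qed
  have right: "val2 x l (f y (scale p v)) = poly p (x + l) * val2 x l (f y v)" for p y
  proof (induction p)
    case 0
    show ?case
      using assms(1) unfolding k_bilinear_iff
      by (metis (no_types, lifting) add_cancel_right_right mult_zero_left poly_0 scale_zero_left
          val2_simps(1))
  next
    case (pCons a p)
    then show ?case
      using assms unfolding scale_pCons[of a p] k_bilinear_iff sesquilinear_def
      by (simp add: algebra_simps del: scale_scale)
  qed
  show ?thesis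
    using left[of "coord u" w] right[of v "coord w"] by (simp add: symbol_def val1_def)
qed

text \<open>
  By sesqui-linearity, a polynomial \<open>P\<close> in the left argument of \<open>g\<^sub>t\<close> contributes its value at
  \<open>\<partial> = -t\<close>, and one in the right argument contributes its value at \<open>\<partial> = x+t\<close>.
\<close>

lemma val3_ext_left:
  assumes "k_bilinear scale g" and "sesquilinear scale g"
  shows "val3 x l m (ext_left scale g t s P w)
    = val2 (- poly3 x l m t) (poly3 x l m s) P * val1 (x + poly3 x l m t) w
        * symbol g x (poly3 x l m t)"
  by (simp add: ext_left_def val3_extend val3_subst_var val2_sesquilinear[OF assms]
      val2_altdef[of "- poly3 x l m t"] sum_distrib_left sum_distrib_right mult_ac)

lemma val3_ext_right:
  assumes "k_bilinear scale g" and "sesquilinear scale g"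
  shows "val3 x l m (ext_right scale g t s u P)
    = val1 (- poly3 x l m t) u * val2 (x + poly3 x l m t) (poly3 x l m s) P
        * symbol g x (poly3 x l m t)"
  by (simp add: ext_right_def val3_extend val3_subst_var val2_sesquilinear[OF assms]
      val2_altdef[of "x + poly3 x l m t"] sum_distrib_left sum_distrib_right mult_ac)

lemma symbol_eq_poly2: "symbol f x l = poly2 x l (map_poly coord (f v v))"
proof -
  have "val2 x l P = poly2 x l (map_poly coord P)" for P
    by (induction P) (simp_all add: map_poly_pCons val1_def)
  then show ?thesis
    by (simp add: symbol_def)
qed

text \<open>
  The sesqui-linear map with \<open>f\<^sub>\<lambda>(v,v) = cv\<close>: for \<open>u = p(\<partial>)v\<close> and \<open>w = q(\<partial>)v\<close> the value is
  \<open>c p(-\<lambda>) q(\<partial>+\<lambda>) v\<close>. For \<open>c = 1\<close> this is \<open>\<epsilon>\<close>.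
\<close>

definition constant_symbol_map :: "'k \<Rightarrow> 'v \<Rightarrow> 'v \<Rightarrow> 'v poly" where
  "constant_symbol_map c u w = poly_scale scale
     ([:[:c:]:] * poly (map_poly (\<lambda>a. [:[:a:]:]) (coord u)) (- lam1)
        * poly (map_poly (\<lambda>a. [:[:a:]:]) (coord w)) (del1 + lam1)) [:v:]"

lemma val2_constant_symbol_map:
  "val2 x l (constant_symbol_map c u w) = c * val1 (- l) u * val1 (x + l) w"
proof -
  have "poly2 x l (poly (map_poly (\<lambda>a. [:[:a:]:]) p) A) = poly p (poly2 x l A)"
    for p :: "'k poly" and A
    by (induction p) (simp_all add: map_poly_pCons)
  then show ?thesis
    by (simp add: constant_symbol_map_def val1_def)
qed

lemma k_bilinear_constant_symbol_map: "k_bilinear scale (constant_symbol_map c)"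
  unfolding k_bilinear_iff
  by (auto intro!: val2_eqI simp: val2_constant_symbol_map algebra_simps)

lemma sesquilinear_constant_symbol_map: "sesquilinear scale (constant_symbol_map c)"
  unfolding sesquilinear_def
  by (auto intro!: val2_eqI simp: val2_constant_symbol_map algebra_simps)

lemma symbol_constant_symbol_map [simp]: "symbol (constant_symbol_map c) x l = c"
  by (simp add: symbol_def val2_constant_symbol_map)

end

section \<open>Cocycles and coboundaries\<close>

locale conformal_rank_one = free_rank_one scale v
  for scale :: "'k::field_char_0 poly \<Rightarrow> 'v::ab_group_add \<Rightarrow> 'v" and v +
  fixes circ :: "'v \<Rightarrow> 'v \<Rightarrow> 'v poly" and \<alpha> :: 'k
  assumes circ_bilinear: "k_bilinear scale circ" and circ_sesquilinear: "sesquilinear scale circ"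
    and circ_v_v: "circ v v = poly_scale scale (del1 + lam1 + [:[:\<alpha>:]:]) [:v:]"
begin

lemma symbol_circ [simp]: "symbol circ x l = x + l + \<alpha>"
  by (simp add: symbol_def circ_v_v)

definition coboundary_symbol :: "'k poly \<Rightarrow> 'k \<Rightarrow> 'k \<Rightarrow> 'k" where
  "coboundary_symbol h x l = (x + l + \<alpha>) * (poly h (x + l) - poly h x + poly h (- l))"

lemma coboundary_symbol_linear [simp]:
  "coboundary_symbol 0 x l = 0"
  "coboundary_symbol (h + k) x l = coboundary_symbol h x l + coboundary_symbol k x l"
  "coboundary_symbol (smult c h) x l = c * coboundary_symbol h x l"
  by (simp_all add: coboundary_symbol_def algebra_simps)

text \<open>
  Each term of a cocycle identity at \<open>(p(\<partial>)v, q(\<partial>)v, r(\<partial>)v)\<close> is its value at \<open>(v,v,v)\<close> times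
  the common factor \<open>p(-\<lambda>) q(-\<mu>) r(\<partial>+\<lambda>+\<mu>)\<close>. So it suffices to test the identities at
  \<open>(v,v,v)\<close>, where they are equations for the symbol.
\<close>

lemma Z2_iff:
  "f \<in> Z2 scale circ \<longleftrightarrow> k_bilinear scale f \<and> sesquilinear scale f \<and>
     (\<forall>x l m. symbol f (x + l) m * (x + l + \<alpha>) - (\<alpha> - m) * symbol f x (l + m)
           + (x + l + m + \<alpha>) * symbol f x l - symbol f (- l - m) l * (x + l + m + \<alpha>)
         = symbol f (x + m) l * (x + m + \<alpha>) - (\<alpha> - l) * symbol f x (l + m)
           + (x + l + m + \<alpha>) * symbol f x m - symbol f (- l - m) m * (x + l + m + \<alpha>)) \<and>
     (\<forall>x l m. (\<alpha> - m) * symbol f x (l + m) + symbol f (- l - m) l * (x + l + m + \<alpha>)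
         = symbol f (x + m) l * (\<alpha> - m) + (x + l + m + \<alpha>) * symbol f x (- x - m))"
    (is "_ \<longleftrightarrow> ?bil \<and> ?ses \<and> (\<forall>x l m. ?L1 x l m = ?R1 x l m) \<and> (\<forall>x l m. ?L2 x l m = ?R2 x l m)")
proof (cases "?bil \<and> ?ses")
  case False
  then show ?thesis
    unfolding Z2_def by blast
next
  case True
  then have f: "?bil" "?ses"
    by auto
  note circ = circ_bilinear circ_sesquilinear
  note vals = val3_ext_left[OF circ] val3_ext_right[OF circ] val3_ext_left[OF f] val3_ext_right[OF f]
    val2_sesquilinear[OF circ] val2_sesquilinear[OF f]
  define l1 where "l1 u v w = ext_right scale circ lam2 mu2 u (f v w)
        - ext_left scale f (lam2 + mu2) lam2 (circ u v) w
        + ext_right scale f lam2 mu2 u (circ v w)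
        - ext_left scale circ (lam2 + mu2) lam2 (f u v) w" for u v w
  define r1 where "r1 u v w = ext_right scale circ mu2 lam2 v (f u w)
        - ext_left scale f (lam2 + mu2) mu2 (circ v u) w
        + ext_right scale f mu2 lam2 v (circ u w)
        - ext_left scale circ (lam2 + mu2) mu2 (f v u) w" for u v w
  define l2 where "l2 u v w = ext_left scale f (lam2 + mu2) lam2 (circ u v) w
        + ext_left scale circ (lam2 + mu2) lam2 (f u v) w" for u v w
  define r2 where "r2 u v w = ext_left scale circ (- del2 - mu2) lam2 (f u w) v
        + ext_left scale f (- del2 - mu2) lam2 (circ u w) v" for u v w
  have l1: "val3 x l m (l1 u v w) = val1 (- l) u * val1 (- m) v * val1 (x + l + m) w * ?L1 x l m"
    for x l m u v w
    unfolding l1_def by (simp add: vals algebra_simps)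
  have r1: "val3 x l m (r1 u v w) = val1 (- l) u * val1 (- m) v * val1 (x + l + m) w * ?R1 x l m"
    for x l m u v w
    unfolding r1_def by (simp add: vals algebra_simps)
  have l2: "val3 x l m (l2 u v w) = val1 (- l) u * val1 (- m) v * val1 (x + l + m) w * ?L2 x l m"
    for x l m u v w
    unfolding l2_def by (simp add: vals algebra_simps)
  have r2: "val3 x l m (r2 u v w) = val1 (- l) u * val1 (- m) v * val1 (x + l + m) w * ?R2 x l m"
    for x l m u v w
  proof -
    have "symbol f x (- m - x) = symbol f x (- x - m)"
      by (rule arg_cong) simp
    then show ?thesis
      unfolding r2_def by (simp add: vals algebra_simps)
  qed
  have "f \<in> Z2 scale circ \<longleftrightarrow> (\<forall>u v w. l1 u v w = r1 u v w) \<and> (\<forall>u v w. l2 u v w = r2 u v w)"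
    unfolding Z2_def l1_def r1_def l2_def r2_def using f by simp
  also have "(\<forall>u v w. l1 u v w = r1 u v w) \<longleftrightarrow> (\<forall>x l m. ?L1 x l m = ?R1 x l m)"
  proof
    assume eq: "\<forall>u v w. l1 u v w = r1 u v w"
    show "\<forall>x l m. ?L1 x l m = ?R1 x l m"
      using l1[of _ _ _ v v v] r1[of _ _ _ v v v] eq by simp
  next
    assume eq: "\<forall>x l m. ?L1 x l m = ?R1 x l m"
    show "\<forall>u v w. l1 u v w = r1 u v w"
    proof (intro allI val3_eqI)
      fix u v w x l m
      have "?L1 x l m = ?R1 x l m"
        using eq by blast
      then show "val3 x l m (l1 u v w) = val3 x l m (r1 u v w)"
        unfolding l1 r1 by (rule arg_cong)
    qed
  qed
  also have "(\<forall>u v w. l2 u v w = r2 u v w) \<longleftrightarrow> (\<forall>x l m. ?L2 x l m = ?R2 x l m)"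
  proof
    assume eq: "\<forall>u v w. l2 u v w = r2 u v w"
    show "\<forall>x l m. ?L2 x l m = ?R2 x l m"
      using l2[of _ _ _ v v v] r2[of _ _ _ v v v] eq by simp
  next
    assume eq: "\<forall>x l m. ?L2 x l m = ?R2 x l m"
    show "\<forall>u v w. l2 u v w = r2 u v w"
    proof (intro allI val3_eqI)
      fix u v w x l m
      have "?L2 x l m = ?R2 x l m"
        using eq by blast
      then show "val3 x l m (l2 u v w) = val3 x l m (r2 u v w)"
        unfolding l2 r2 by (rule arg_cong)
    qed
  qed
  finally show ?thesis
    using f by blast
qed

lemma constant_symbol_map_in_Z2: "constant_symbol_map c \<in> Z2 scale circ"
  unfolding Z2_iff
  using k_bilinear_constant_symbol_map sesquilinear_constant_symbol_map
  by (simp add: algebra_simps)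

lemma symbol_of_cocycle:
  assumes "f \<in> Z2 scale circ"
  shows "\<exists>c h. \<forall>x l. symbol f x l = c + coboundary_symbol h x l"
  using assms unfolding Z2_iff symbol_eq_poly2 coboundary_symbol_def
  by (intro cocycle_functional_equations) blast+

text \<open>
  An \<open>H\<close>-linear \<open>\<tau>\<close> is multiplication by the coordinate \<open>h\<close> of \<open>\<tau>(v)\<close>; in \<open>d\<^sup>1\<tau>\<close> it acts on the
  right argument as \<open>h(\<partial>+\<lambda>)\<close>, on the product as \<open>h(\<partial>)\<close> and on the left argument as \<open>h(-\<lambda>)\<close>.
\<close>

lemma B2_iff:
  "b \<in> B2 scale circ \<longleftrightarrow> (\<exists>h. \<forall>u w x l. val2 x l (b u w)
     = val1 (- l) u * val1 (x + l) w
         * coboundary_symbol h x l)"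
proof -
  have val2_d1: "val2 x l (d1 circ \<tau> u w) = val1 (- l) u * val1 (x + l) w
         * coboundary_symbol h x l"
    if \<tau>: "\<And>y. coord (\<tau> y) = h * coord y" for \<tau> h x l u w
  proof -
    have "\<tau> 0 = 0"
      using \<tau>[of 0] coord_eq_iff[of "\<tau> 0" 0] by simp
    have "val2 x l (map_poly \<tau> P) = poly h x * val2 x l P" for P
      by (induction P) (simp_all add: map_poly_pCons \<open>\<tau> 0 = 0\<close> val1_def \<tau> algebra_simps)
    moreover have "val1 y (\<tau> z) = poly h y * val1 y z" for y z
      by (simp add: val1_def \<tau>)
    ultimately show ?thesis
      by (simp add: coboundary_symbol_def d1_def val2_sesquilinear[OF circ_bilinear circ_sesquilinear]
          algebra_simps)
  qed
  show ?thesis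
  proof
    assume "b \<in> B2 scale circ"
    then obtain \<tau> where b: "b = d1 circ \<tau>" and hom: "module_hom scale scale \<tau>"
      unfolding B2_def by blast
    have "coord (\<tau> y) = coord (\<tau> v) * coord y" for y
      using module_hom.scale[OF hom, of "coord y" v] by simp
    from val2_d1[OF this] show "\<exists>h. \<forall>u w x l. val2 x l (b u w)
       = val1 (- l) u * val1 (x + l) w
         * coboundary_symbol h x l"
      unfolding b by blast
  next
    assume "\<exists>h. \<forall>u w x l. val2 x l (b u w)
       = val1 (- l) u * val1 (x + l) w
         * coboundary_symbol h x l"
    then obtain h where h: "\<And>u w x l. val2 x l (b u w)
       = val1 (- l) u * val1 (x + l) w
         * coboundary_symbol h x l"
      by blast
    have "module_hom scale scale (\<lambda>u. scale h u)"
      by unfold_locales (simp_all add: scale_right_distrib mult.commute)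
    moreover have "b = d1 circ (\<lambda>u. scale h u)"
      by (intro ext val2_eqI) (simp add: h val2_d1[where h = h])
    ultimately show "b \<in> B2 scale circ"
      unfolding B2_def by blast
  qed
qed

lemma B2_zero: "0 \<in> B2 scale circ"
  unfolding B2_iff by (auto intro: exI[of _ 0])

lemma B2_add: "a \<in> B2 scale circ \<Longrightarrow> b \<in> B2 scale circ \<Longrightarrow> a + b \<in> B2 scale circ"
  unfolding B2_iff
proof (elim exE)
  fix h k
  assume "\<forall>u w x l. val2 x l (a u w) = val1 (- l) u * val1 (x + l) w
         * coboundary_symbol h x l"
    and "\<forall>u w x l. val2 x l (b u w) = val1 (- l) u * val1 (x + l) w
         * coboundary_symbol k x l"
  then show "\<exists>h. \<forall>u w x l. val2 x l ((a + b) u w) = val1 (- l) u * val1 (x + l) w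
         * coboundary_symbol h x l"
    by (intro exI[of _ "h + k"]) (simp add: algebra_simps)
qed

abbreviation kscale :: "'k \<Rightarrow> ('v \<Rightarrow> 'v \<Rightarrow> 'v poly) \<Rightarrow> 'v \<Rightarrow> 'v \<Rightarrow> 'v poly" where
  "kscale c f \<equiv> \<lambda>u w. poly_scale scale [:[:c:]:] (f u w)"

lemma B2_scale: "b \<in> B2 scale circ \<Longrightarrow> kscale c b \<in> B2 scale circ"
  unfolding B2_iff
proof (elim exE)
  fix h
  assume "\<forall>u w x l. val2 x l (b u w) = val1 (- l) u * val1 (x + l) w
         * coboundary_symbol h x l"
  then show "\<exists>h. \<forall>u w x l. val2 x l (kscale c b u w) = val1 (- l) u * val1 (x + l) w
         * coboundary_symbol h x l"
    by (intro exI[of _ "smult c h"]) (simp add: algebra_simps)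
qed

lemma B2_uminus:
  assumes "b \<in> B2 scale circ"
  shows "- b \<in> B2 scale circ"
proof -
  have "kscale (- 1) b = - b"
  proof (intro ext val2_eqI)
    show "val2 x l (kscale (- 1) b u w) = val2 x l ((- b) u w)" for x l u w
      using val2_diff[of x l 0 "b u w"] by simp
  qed
  then show ?thesis
    using B2_scale[OF assms, of "- 1"] by simp
qed

lemma B2_coset_eqI:
  assumes "f - g \<in> B2 scale circ"
  shows "f +o B2 scale circ = g +o B2 scale circ"
proof -
  have sub: "f +o B2 scale circ \<subseteq> g +o B2 scale circ" if "f - g \<in> B2 scale circ" for f g
  proof
    fix a assume "a \<in> f +o B2 scale circ"
    then obtain b where "b \<in> B2 scale circ" "a = f + b"
      unfolding elt_set_plus_def by blast
    moreover have "a = g + ((f - g) + b)"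
      using \<open>a = f + b\<close> by (simp add: algebra_simps)
    moreover have "(f - g) + b \<in> B2 scale circ"
      by (intro B2_add that \<open>b \<in> B2 scale circ\<close>)
    ultimately show "a \<in> g +o B2 scale circ"
      unfolding elt_set_plus_def by blast
  qed
  have "g - f \<in> B2 scale circ"
    using B2_uminus[OF assms] by simp
  with sub assms show ?thesis
    by blast
qed

text \<open>
  The union defining \<^const>\<open>H2_scale\<close> runs over all representatives of a coset, and each of them yields
  the same coset because \<open>B\<^sup>2\<close> is closed under scalars.
\<close>

lemma H2_scale_coset: "H2_scale scale circ c (f +o B2 scale circ) = kscale c f +o B2 scale circ"
proof -
  have "kscale c g +o B2 scale circ = kscale c f +o B2 scale circ" if g: "g \<in> f +o B2 scale circ" for g
  proof (rule B2_coset_eqI)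
    obtain b where b: "b \<in> B2 scale circ" "g = f + b"
      using g unfolding elt_set_plus_def by blast
    have "kscale c g - kscale c f = kscale c b"
      by (intro ext val2_eqI) (simp add: b algebra_simps)
    then show "kscale c g - kscale c f \<in> B2 scale circ"
      using B2_scale[OF b(1)] by simp
  qed
  moreover have "f \<in> f +o B2 scale circ"
    using B2_zero unfolding elt_set_plus_def by force
  ultimately show ?thesis
    unfolding H2_scale_def by blast
qed

lemma constant_symbol_map_1: "constant_symbol_map 1 v v = [:v:]"
  by (rule val2_eqI) (simp add: val2_constant_symbol_map)

lemma cocycle_with_value_v:
  assumes "\<epsilon> \<in> Z2 scale circ" and "\<epsilon> v v = [:v:]"
  shows "\<epsilon> = constant_symbol_map 1"
proof (intro ext val2_eqI)
  have "k_bilinear scale \<epsilon>" "sesquilinear scale \<epsilon>"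
    using assms(1) unfolding Z2_iff by auto
  from val2_sesquilinear[OF this]
  show "val2 x l (\<epsilon> u w) = val2 x l (constant_symbol_map 1 u w)" for x l u w
    by (simp add: val2_constant_symbol_map symbol_def assms(2))
qed

lemma kscale_constant_symbol_map: "kscale c (constant_symbol_map 1) = constant_symbol_map c"
  by (intro ext val2_eqI) (simp add: val2_constant_symbol_map)

lemma H2_generated:
  "H2 scale circ = {H2_scale scale circ c (constant_symbol_map 1 +o B2 scale circ) | c. True}"
proof -
  have "\<exists>c. f +o B2 scale circ = constant_symbol_map c +o B2 scale circ"
    if f: "f \<in> Z2 scale circ" for f
  proof -
    obtain c h where "\<And>x l. symbol f x l
        = c + coboundary_symbol h x l"
      using symbol_of_cocycle[OF f] by blast
    moreover have "k_bilinear scale f" "sesquilinear scale f"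
      using f unfolding Z2_iff by auto
    ultimately have "f - constant_symbol_map c \<in> B2 scale circ"
      unfolding B2_iff
      by (intro exI[of _ h]) (simp add: val2_sesquilinear val2_constant_symbol_map algebra_simps)
    then show ?thesis
      using B2_coset_eqI by blast
  qed
  then show ?thesis
    unfolding H2_def H2_scale_coset kscale_constant_symbol_map
    using constant_symbol_map_in_Z2 by blast
qed

lemma constant_symbol_map_not_coboundary: "constant_symbol_map 1 \<notin> B2 scale circ"
proof
  assume "constant_symbol_map 1 \<in> B2 scale circ"
  then obtain h where h: "\<And>u w x l. val2 x l (constant_symbol_map 1 u w)
       = val1 (- l) u * val1 (x + l) w
         * coboundary_symbol h x l"
    unfolding B2_iff by blast
  \<comment> \<open>At \<open>x = 0\<close>, \<open>l = - \<alpha>\<close> the factor \<open>x + l + \<alpha>\<close> vanishes.\<close>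
  show False
    using h[of 0 "- \<alpha>" v v] by (simp add: coboundary_symbol_def val2_constant_symbol_map)
qed

end

theorem theorem5:
  fixes scale :: "'k::field_char_0 poly \<Rightarrow> 'v::ab_group_add \<Rightarrow> 'v"
    and circ :: "'v \<Rightarrow> 'v \<Rightarrow> 'v poly"
    and v :: 'v
    and \<alpha> :: 'k
  assumes "novikov_conformal_algebra scale circ"
    and "\<not> module.dependent scale {v}"
    and "module.span scale {v} = UNIV"
    and "circ v v = poly_scale scale (del1 + lam1 + [:[:\<alpha>:]:]) [:v:]"
  shows "(\<exists>!\<epsilon>. \<epsilon> \<in> Z2 scale circ \<and> \<epsilon> v v = [:v:]) \<and>
    (\<forall>\<epsilon>. \<epsilon> \<in> Z2 scale circ \<and> \<epsilon> v v = [:v:] \<longrightarrow>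
       H2 scale circ = {H2_scale scale circ c (\<epsilon> +o B2 scale circ) | c. True} \<and>
       \<epsilon> +o B2 scale circ \<noteq> B2 scale circ)"
proof -
  interpret novikov_conformal_algebra scale circ
    by (rule assms(1))
  interpret conformal_rank_one scale v circ \<alpha>
    by unfold_locales (fact assms circ_bilinear circ_sesquilinear)+
  have "constant_symbol_map 1 +o B2 scale circ \<noteq> B2 scale circ"
    using constant_symbol_map_not_coboundary B2_zero unfolding elt_set_plus_def by force
  then show ?thesis
    using cocycle_with_value_v constant_symbol_map_in_Z2 constant_symbol_map_1 H2_generated
    by blast
qed

end
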